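(* For each positive integer $n$, let $f(n)$ be the maximum of $a_1+\cdots+a_n$ over all packings of $n$ non-overlapping squares, with side lengths $a_1,\ldots,a_n$, inside a unit square. For each positive integer $k$ let $\epsilon(k):=f(k^2+1)-k$. Then $f(k^2+1)=k$ for all positive integers $k$ if and only if the series $\sum_{k\geqslant 1}\epsilon(k)$ converges. Additionally, if $f(k^2+1)=k$ for infinitely many positive integers $k$, then $f(k^2+1)=k$ for all positive integers $k$.
   Context: A packing of $n$ non-overlapping squares inside the unit square means $n$ squares contained in the (closed) unit square with pairwise disjoint interiors. The small squares may have different sizes and arbitrary positions and orientations (they need not have sides parallel to those of the unit square). *)

theory Defs
  imports "HOL-Analysis.Analysis"
begin

definition unit_square :: "(real ^ 2) set" where
  "unit_square = cbox 0 1"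

text \<open>A closed, non-degenerate square in arbitrary position: \<open>p\<close> is a vertex, and \<open>u\<close>, \<open>v\<close> are
  the two edge vectors emanating from it.\<close>

definition is_square :: "(real ^ 2) set \<Rightarrow> real \<Rightarrow> bool" where
  "is_square S a \<longleftrightarrow> a > 0 \<and>
     (\<exists>p u v. norm u = a \<and> norm v = a \<and> u \<bullet> v = 0 \<and>
        S = {p + s *\<^sub>R u + t *\<^sub>R v | s t. s \<in> {0..1} \<and> t \<in> {0..1}})"

definition square_packing :: "nat \<Rightarrow> (nat \<Rightarrow> (real ^ 2) set) \<Rightarrow> (nat \<Rightarrow> real) \<Rightarrow> bool" where
  "square_packing n S a \<longleftrightarrow>
     (\<forall>i<n. is_square (S i) (a i) \<and> S i \<subseteq> unit_square) \<and>
     disjoint_family_on (\<lambda>i. interior (S i)) {..<n}"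

text \<open>\<open>GREATEST\<close> is a genuine maximum: its value is meaningful only if some packing attains it.\<close>

definition max_side_sum :: "nat \<Rightarrow> real" where
  "max_side_sum n = (GREATEST s. \<exists>S a. square_packing n S a \<and> s = (\<Sum>i<n. a i))"

definition excess :: "nat \<Rightarrow> real" where
  "excess k = max_side_sum (k\<^sup>2 + 1) - real k"

end

theory Submission
  imports Defs
begin

text \<open>
  Write \<open>f\<close> for \<^const>\<open>max_side_sum\<close> and \<open>\<epsilon>\<close> for \<^const>\<open>excess\<close>. Everything follows from
  \<open>\<epsilon>(k) \<ge> 0\<close> and the fact that \<open>K \<epsilon>(K)\<close> is nondecreasing in \<open>K\<close>.

  For the monotonicity, let \<open>k \<le> K\<close>, cut the unit square into \<open>K\<^sup>2\<close> equal cells, and replace a block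
  of \<open>k \<times> k\<close> cells by an optimal packing of \<open>k\<^sup>2 + 1\<close> squares, scaled by \<open>k/K\<close>. This yields
  \<open>K\<^sup>2 + 1\<close> squares of side sum \<open>(K\<^sup>2 - k\<^sup>2)/K + (k/K)(k + \<epsilon>(k)) = K + (k/K) \<epsilon>(k)\<close>, so
  \<open>\<epsilon>(K) \<ge> (k/K) \<epsilon>(k)\<close> (\<open>attainable_block\<close>, \<open>excess_lower_bound\<close>). The same construction with \<open>k = 1\<close>,
  started from two half-size squares on a diagonal, gives \<open>\<epsilon>(K) \<ge> 0\<close>.

  If \<open>\<epsilon>(k) > 0\<close> for one \<open>k\<close>, then \<open>\<epsilon>\<close> dominates a positive multiple of the harmonic sequence and
  its series diverges; and \<open>\<epsilon>(K) = 0\<close> forces \<open>\<epsilon>(k) = 0\<close> for all \<open>k \<le> K\<close>, so infinitely many zeros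
  make all of them vanish.

  The argument speaks of optimal packings, so the maximum must exist. Packings whose squares may
  degenerate to points form a compact set, on which the side sum is continuous. A maximiser may
  contain degenerate squares; dropping these and then repeatedly splitting a square into two half-size
  squares along its diagonal restores the number of squares without changing the side sum
  (\<open>maximum_attained\<close>).
\<close>

section \<open>Squares given by a vertex and two edge vectors\<close>

definition parallelogram :: "real ^ 2 \<Rightarrow> real ^ 2 \<Rightarrow> real ^ 2 \<Rightarrow> (real ^ 2) set" where
  "parallelogram p u v = {p + s *\<^sub>R u + t *\<^sub>R v | s t. s \<in> {0..1} \<and> t \<in> {0..1}}"

text \<open>For orthogonal nonzero edges this is the interior of the parallelogram. Being given by strict
  inequalities, it also depends openly on \<open>p\<close>, \<open>u\<close>, \<open>v\<close>, which is what makes non-overlapping a closed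
  condition in the compactness argument; for zero edges it is empty.\<close>

definition open_core :: "real ^ 2 \<Rightarrow> real ^ 2 \<Rightarrow> real ^ 2 \<Rightarrow> (real ^ 2) set" where
  "open_core p u v = {x. 0 < (x - p) \<bullet> u \<and> (x - p) \<bullet> u < u \<bullet> u \<and>
                         0 < (x - p) \<bullet> v \<and> (x - p) \<bullet> v < v \<bullet> v}"

lemma is_square_iff:
  "is_square S a \<longleftrightarrow> a > 0 \<and> (\<exists>p u v. norm u = a \<and> norm v = a \<and> u \<bullet> v = 0 \<and> S = parallelogram p u v)"
  unfolding is_square_def parallelogram_def by blast

lemma unit_square_iff: "x \<in> unit_square \<longleftrightarrow> 0 \<le> x $ 1 \<and> x $ 1 \<le> 1 \<and> 0 \<le> x $ 2 \<and> x $ 2 \<le> 1"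
  unfolding unit_square_def by (auto simp: mem_box_cart forall_2)

text \<open>The remainder of the expansion is orthogonal to both \<open>u\<close> and \<open>v\<close>. It vanishes by Cramer's rule,
  because the determinant of the frame satisfies \<open>d\<^sup>2 = (u \<bullet> u) (v \<bullet> v) - (u \<bullet> v)\<^sup>2 \<noteq> 0\<close>.\<close>

lemma orthogonal_frame_expansion:
  fixes u v w :: "real ^ 2"
  assumes "u \<bullet> v = 0" "u \<noteq> 0" "v \<noteq> 0"
  shows "w = (w \<bullet> u / (u \<bullet> u)) *\<^sub>R u + (w \<bullet> v / (v \<bullet> v)) *\<^sub>R v"
proof -
  define r where "r = w - ((w \<bullet> u / (u \<bullet> u)) *\<^sub>R u + (w \<bullet> v / (v \<bullet> v)) *\<^sub>R v)"
  have ru: "r \<bullet> u = 0" and rv: "r \<bullet> v = 0"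
    using assms by (auto simp: r_def algebra_simps inner_commute)
  define d where "d = u $ 1 * v $ 2 - u $ 2 * v $ 1"
  have "d\<^sup>2 = (u \<bullet> u) * (v \<bullet> v) - (u \<bullet> v)\<^sup>2"
    by (simp add: d_def inner_vec_def sum_2 power2_eq_square algebra_simps)
  hence "d \<noteq> 0" using assms by auto
  moreover have "r $ 1 * d = (r \<bullet> u) * v $ 2 - (r \<bullet> v) * u $ 2"
    "r $ 2 * d = (r \<bullet> v) * u $ 1 - (r \<bullet> u) * v $ 1"
    by (simp_all add: d_def inner_vec_def sum_2 algebra_simps)
  ultimately have "r = 0" using ru rv by (simp add: vec_eq_iff forall_2)
  thus ?thesis by (simp add: r_def)
qed

lemma interior_parallelogram:
  assumes "u \<bullet> v = 0" "u \<noteq> 0" "v \<noteq> 0"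
  shows "interior (parallelogram p u v) = open_core p u v"
proof
  have "open (open_core p u v)"
    unfolding open_core_def by (intro open_Collect_conj open_Collect_less continuous_intros)
  moreover have "open_core p u v \<subseteq> parallelogram p u v"
  proof
    fix x assume x: "x \<in> open_core p u v"
    have "u \<bullet> u > 0" "v \<bullet> v > 0" using assms by auto
    with x have "(x - p) \<bullet> u / (u \<bullet> u) \<in> {0..1}" "(x - p) \<bullet> v / (v \<bullet> v) \<in> {0..1}"
      by (auto simp: open_core_def)
    moreover have "x = p + ((x - p) \<bullet> u / (u \<bullet> u)) *\<^sub>R u + ((x - p) \<bullet> v / (v \<bullet> v)) *\<^sub>R v"
      using orthogonal_frame_expansion[OF assms, of "x - p"] by (simp add: algebra_simps)
    ultimately show "x \<in> parallelogram p u v" unfolding parallelogram_def by blast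
  qed
  ultimately show "open_core p u v \<subseteq> interior (parallelogram p u v)"
    by (rule interior_maximal[rotated])
next
  have bounds: "0 \<le> (x - p) \<bullet> u \<and> (x - p) \<bullet> u \<le> u \<bullet> u \<and> 0 \<le> (x - p) \<bullet> v \<and> (x - p) \<bullet> v \<le> v \<bullet> v"
    if "x \<in> parallelogram p u v" for x
    using that assms by (auto simp: parallelogram_def algebra_simps inner_commute mult_left_le_one_le)
  show "interior (parallelogram p u v) \<subseteq> open_core p u v"
  proof
    fix x assume "x \<in> interior (parallelogram p u v)"
    then obtain e where e: "e > 0" "cball x e \<subseteq> parallelogram p u v"
      by (meson mem_interior_cball)
    \<comment> \<open>A boundary point would leave the square when moved along one of the edge vectors.\<close>
    have strict: "0 < (x - p) \<bullet> w \<and> (x - p) \<bullet> w < w \<bullet> w" if w: "w = u \<or> w = v" for w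
    proof -
      have nz: "norm w > 0" using w assms by auto
      define d where "d = e / norm w"
      have "d > 0" using nz e by (simp add: d_def)
      have "x + d *\<^sub>R w \<in> cball x e" "x - d *\<^sub>R w \<in> cball x e"
        using nz e by (auto simp: d_def dist_norm)
      hence "x + d *\<^sub>R w \<in> parallelogram p u v" "x - d *\<^sub>R w \<in> parallelogram p u v"
        using e by auto
      hence "(x + d *\<^sub>R w - p) \<bullet> w \<le> w \<bullet> w" "0 \<le> (x - d *\<^sub>R w - p) \<bullet> w"
        using bounds w by blast+
      moreover have "d * (w \<bullet> w) > 0" using \<open>d > 0\<close> nz by simp
      ultimately show ?thesis by (simp add: algebra_simps)
    qed
    show "x \<in> open_core p u v" using strict[of u] strict[of v] by (simp add: open_core_def)
  qed
qed

section \<open>Attainable side sums\<close>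

text \<open>Arbitrary index sets spare the explicit numbering of the squares in the constructions below.\<close>

definition packing_on :: "'i set \<Rightarrow> ('i \<Rightarrow> (real ^ 2) set) \<Rightarrow> ('i \<Rightarrow> real) \<Rightarrow> bool" where
  "packing_on I S a \<longleftrightarrow>
     (\<forall>i\<in>I. is_square (S i) (a i) \<and> S i \<subseteq> unit_square) \<and>
     disjoint_family_on (\<lambda>i. interior (S i)) I"

definition attainable :: "nat \<Rightarrow> real \<Rightarrow> bool" where
  "attainable n s \<longleftrightarrow> (\<exists>S a. square_packing n S a \<and> s = (\<Sum>i<n. a i))"

lemma square_packing_eq: "square_packing n = packing_on {..<n}"
  unfolding square_packing_def packing_on_def by (intro ext) auto

lemma packing_on_imp_attainable:
  assumes "finite I" "packing_on I S a"
  shows "attainable (card I) (sum a I)"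
proof -
  obtain h where h: "bij_betw h {..<card I} I"
    using assms(1) ex_bij_betw_nat_finite[of I] by (auto simp: atLeast0LessThan)
  have "packing_on {..<card I} (S \<circ> h) (a \<circ> h)"
  proof -
    have in_I: "h i \<in> I" if "i < card I" for i using h that by (auto simp: bij_betw_def)
    have "h i \<noteq> h j" if "i < card I" "j < card I" "i \<noteq> j" for i j
      using h that by (auto simp: bij_betw_def inj_on_def)
    with in_I assms(2) show ?thesis unfolding packing_on_def disjoint_family_on_def by simp
  qed
  moreover have "sum a I = (\<Sum>i<card I. (a \<circ> h) i)"
    using sum.reindex_bij_betw[OF h, of a] by simp
  ultimately show ?thesis unfolding attainable_def square_packing_eq by blast
qed

text \<open>The similarity \<open>w \<mapsto> p + w\<^sub>1 u + w\<^sub>2 v\<close> carries the unit square onto the square with vertex \<open>p\<close> and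
  edges \<open>u\<close>, \<open>v\<close>; it multiplies inner products by \<open>c\<^sup>2\<close> and is a homeomorphism, so it preserves squares
  and commutes with taking interiors.\<close>

lemma similarity_image_of_packing:
  fixes T :: "'j \<Rightarrow> (real ^ 2) set"
  assumes "is_square Q c" "packing_on J T b"
  obtains T' where "\<And>j. j \<in> J \<Longrightarrow> is_square (T' j) (c * b j)" "\<And>j. j \<in> J \<Longrightarrow> T' j \<subseteq> Q"
    "disjoint_family_on (\<lambda>j. interior (T' j)) J"
proof -
  obtain p u v where c: "c > 0" and uv: "norm u = c" "norm v = c" "u \<bullet> v = 0"
    and Q: "Q = parallelogram p u v"
    using assms(1) unfolding is_square_iff by auto
  define L :: "real ^ 2 \<Rightarrow> real ^ 2" where "L w = (w $ 1) *\<^sub>R u + (w $ 2) *\<^sub>R v" for w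
  have lin: "linear L"
    by (rule linearI) (simp_all add: L_def algebra_simps)
  have uu: "u \<bullet> u = c\<^sup>2" "v \<bullet> v = c\<^sup>2" using uv by (simp_all add: dot_square_norm)
  have inner: "L w \<bullet> L w' = c\<^sup>2 * (w \<bullet> w')" for w w'
    using uv(3) uu by (simp add: L_def inner_add_left inner_add_right inner_commute[of v u]
        inner_vec_def[of w w'] sum_2 algebra_simps)
  have norm: "norm (L w) = c * norm w" for w
    using c inner[of w w] by (simp add: norm_eq_sqrt_inner real_sqrt_mult)
  have inj: "inj L"
    unfolding linear_injective_0[OF lin] using norm c
    by (metis mult_eq_0_iff norm_eq_zero order_less_irrefl)
  define T' where "T' j = (+) p ` L ` T j" for j
  have int: "interior (T' j) = (+) p ` L ` interior (T j)" for j
    using lin inj by (simp add: T'_def interior_translation interior_injective_linear_image)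
  show thesis
  proof
    fix j assume j: "j \<in> J"
    then obtain q x y where b: "b j > 0" and xy: "norm x = b j" "norm y = b j" "x \<bullet> y = 0"
      and T: "T j = parallelogram q x y"
      using assms(2) unfolding packing_on_def is_square_iff by blast
    have img: "p + L (q + s *\<^sub>R x + t *\<^sub>R y) = (p + L q) + s *\<^sub>R L x + t *\<^sub>R L y" for s t
      using lin by (simp add: linear_add linear_scale)
    have "T' j = parallelogram (p + L q) (L x) (L y)"
    proof -
      have "T' j = {p + L (q + s *\<^sub>R x + t *\<^sub>R y) | s t. s \<in> {0..1} \<and> t \<in> {0..1}}"
        unfolding T'_def T parallelogram_def by blast
      thus ?thesis unfolding img parallelogram_def .
    qed
    moreover have "norm (L x) = c * b j" "norm (L y) = c * b j" "L x \<bullet> L y = 0"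
      using norm xy inner by auto
    ultimately show "is_square (T' j) (c * b j)"
      using b c unfolding is_square_iff by (intro conjI exI) auto
    have "T j \<subseteq> unit_square" using assms(2) j by (auto simp: packing_on_def)
    moreover have "p + L w \<in> Q" if "w \<in> unit_square" for w
      unfolding Q parallelogram_def L_def mem_Collect_eq using that
      by (intro exI[of _ "w $ 1"] exI[of _ "w $ 2"]) (simp add: unit_square_iff add.assoc)
    ultimately show "T' j \<subseteq> Q" unfolding T'_def by blast
  next
    show "disjoint_family_on (\<lambda>j. interior (T' j)) J"
      unfolding disjoint_family_on_def
    proof (intro ballI impI)
      fix i j assume "i \<in> J" "j \<in> J" "i \<noteq> j"
      hence "interior (T i) \<inter> interior (T j) = {}"
        using assms(2) by (simp add: packing_on_def disjoint_family_on_def)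
      thus "interior (T' i) \<inter> interior (T' j) = {}"
        unfolding int using inj by (simp flip: image_Int)
    qed
  qed
qed

text \<open>The only way in which packings are modified: one square is refilled with a scaled copy of a whole
  packing of the unit square.\<close>

lemma attainable_replace:
  assumes "finite I" "packing_on I S a" "i \<in> I" "attainable m s"
  shows "attainable (card I - 1 + m) (sum a (I - {i}) + a i * s)"
proof -
  obtain T b where T: "packing_on {..<m} T b" and s: "s = (\<Sum>j<m. b j)"
    using assms(4) by (auto simp: attainable_def square_packing_eq)
  obtain T' where T': "\<And>j. j < m \<Longrightarrow> is_square (T' j) (a i * b j)" "\<And>j. j < m \<Longrightarrow> T' j \<subseteq> S i"
    "disjoint_family_on (\<lambda>j. interior (T' j)) {..<m}"
    using similarity_image_of_packing[OF _ T, of "S i" "a i"] assms(2,3)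
    by (auto simp: packing_on_def)
  define J where "J = (I - {i}) <+> {..<m}"
  have J_iff: "Inl x \<in> J \<longleftrightarrow> x \<in> I \<and> x \<noteq> i" "Inr j \<in> J \<longleftrightarrow> j < m" for x j
    by (auto simp: J_def)
  have dis: "interior (S x) \<inter> interior (T' y) = {}" if "x \<in> I" "x \<noteq> i" "y < m" for x y
    using that interior_mono[OF T'(2)] assms(2,3)
    unfolding packing_on_def disjoint_family_on_def by fast
  have "packing_on J (case_sum S T') (case_sum a (\<lambda>j. a i * b j))"
    unfolding packing_on_def disjoint_family_on_def
  proof (intro conjI ballI impI)
    fix x assume x: "x \<in> J"
    have S: "is_square (S x) (a x) \<and> S x \<subseteq> unit_square" if "x \<in> I" for x
      using assms(2) that by (simp add: packing_on_def)
    have T'_unit: "T' j \<subseteq> unit_square" if "j < m" for j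
      using T'(2)[OF that] S[OF assms(3)] by (meson order_trans)
    show "is_square (case_sum S T' x) (case_sum a (\<lambda>j. a i * b j) x)"
      by (cases x) (use x S T'(1) in \<open>auto simp: J_iff\<close>)
    show "case_sum S T' x \<subseteq> unit_square"
    proof (cases x)
      case (Inl y)
      with x S[of y] show ?thesis by (simp add: J_iff)
    next
      case (Inr y)
      with x T'_unit[of y] show ?thesis by (simp add: J_iff)
    qed
  next
    fix x y assume "x \<in> J" "y \<in> J" "x \<noteq> y"
    moreover have "interior (S x) \<inter> interior (S y) = {}" if "x \<in> I" "y \<in> I" "x \<noteq> y" for x y
      using assms(2) that by (simp add: packing_on_def disjoint_family_on_def)
    moreover have "interior (T' x) \<inter> interior (T' y) = {}" if "x < m" "y < m" "x \<noteq> y" for x y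
      using T'(3) that by (simp add: disjoint_family_on_def)
    ultimately show "interior (case_sum S T' x) \<inter> interior (case_sum S T' y) = {}"
      using dis by (cases x; cases y) (simp_all add: J_iff Int_commute)
  qed
  moreover have "finite J" "card J = card I - 1 + m"
    using assms(1,3) by (auto simp: J_def card_Plus)
  moreover have "sum (case_sum a (\<lambda>j. a i * b j)) J = sum a (I - {i}) + a i * s"
    using assms(1) by (simp add: J_def sum.Plus s sum_distrib_left)
  ultimately show ?thesis using packing_on_imp_attainable by metis
qed

section \<open>Packings by axis-parallel squares\<close>

definition axis_square :: "real \<Rightarrow> real \<Rightarrow> real \<Rightarrow> (real ^ 2) set" where
  "axis_square x y c = parallelogram (vector [x, y]) (axis 1 c) (axis 2 c)"

lemma interior_axis_square:
  assumes "c > 0"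
  shows "z \<in> interior (axis_square x y c) \<longleftrightarrow> x < z $ 1 \<and> z $ 1 < x + c \<and> y < z $ 2 \<and> z $ 2 < y + c"
proof -
  have "interior (axis_square x y c) = open_core (vector [x, y]) (axis 1 c) (axis 2 c)"
    unfolding axis_square_def using assms by (intro interior_parallelogram)
      (simp_all add: inner_axis_axis)
  thus ?thesis using assms
    by (simp add: open_core_def inner_axis inner_axis_axis zero_less_mult_iff) (auto simp: algebra_simps)
qed

lemma axis_square_in_unit_square:
  assumes "c > 0" "0 \<le> x" "x + c \<le> 1" "0 \<le> y" "y + c \<le> 1"
  shows "is_square (axis_square x y c) c" "axis_square x y c \<subseteq> unit_square"
proof -
  show "is_square (axis_square x y c) c"
  proof -
    have "norm (axis 1 c :: real ^ 2) = c" "norm (axis 2 c :: real ^ 2) = c"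
      "axis 1 c \<bullet> (axis 2 c :: real ^ 2) = 0"
      using assms(1) by (simp_all add: norm_eq_sqrt_inner inner_axis_axis)
    thus ?thesis unfolding is_square_iff axis_square_def using assms(1) by blast
  qed
  have bounds: "0 \<le> x + s * c \<and> x + s * c \<le> 1 \<and> 0 \<le> y + s * c \<and> y + s * c \<le> 1" if "0 \<le> s" "s \<le> 1" for s
  proof -
    have "0 \<le> s * c" "s * c \<le> c" using that assms(1) by (auto simp: mult_left_le_one_le)
    thus ?thesis using assms by linarith
  qed
  show "axis_square x y c \<subseteq> unit_square"
  proof
    fix z assume "z \<in> axis_square x y c"
    then obtain s t where st: "0 \<le> s" "s \<le> 1" "0 \<le> t" "t \<le> 1"
      and z: "z = vector [x, y] + s *\<^sub>R axis 1 c + t *\<^sub>R axis 2 c"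
      unfolding axis_square_def parallelogram_def by auto
    have "z $ 1 = x + s * c" "z $ 2 = y + t * c" by (simp_all add: z axis_def)
    thus "z \<in> unit_square" using bounds[OF st(1,2)] bounds[OF st(3,4)] by (simp add: unit_square_iff)
  qed
qed

lemma attainable_one: "attainable 1 1"
  using packing_on_imp_attainable[of "{()}" "\<lambda>_. axis_square 0 0 1" "\<lambda>_. 1"]
    axis_square_in_unit_square[of 1 0 0]
  by (simp add: packing_on_def disjoint_family_on_def)

lemma attainable_two: "attainable 2 1"
proof -
  let ?S = "\<lambda>b. if b then axis_square 0 0 (1/2) else axis_square (1/2) (1/2) (1/2)"
  have "interior (?S b) \<inter> interior (?S b') = {}" if "b \<noteq> b'" for b b'
    using that by (cases b; cases b') (auto simp: interior_axis_square)
  hence "packing_on UNIV ?S (\<lambda>_. 1/2)"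
    using axis_square_in_unit_square[of "1/2" 0 0] axis_square_in_unit_square[of "1/2" "1/2" "1/2"]
    by (simp add: packing_on_def disjoint_family_on_def)
  from packing_on_imp_attainable[OF _ this] show ?thesis by simp
qed

text \<open>A square can be replaced by two squares of half its size, placed along its diagonal.\<close>

lemma attainable_Suc:
  assumes "attainable n s" "n \<ge> 1"
  shows "attainable (Suc n) s"
proof -
  obtain S a where S: "packing_on {..<n} S a" and s: "s = (\<Sum>i<n. a i)"
    using assms(1) by (auto simp: attainable_def square_packing_eq)
  have "attainable (card {..<n} - 1 + 2) (sum a ({..<n} - {0}) + a 0 * 1)"
    using assms(2) by (intro attainable_replace[OF _ S _ attainable_two]) auto
  moreover have "sum a ({..<n} - {0}) + a 0 * 1 = s"
    using assms(2) by (simp add: s sum_diff1)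
  ultimately show ?thesis using assms(2) by simp
qed

lemma attainable_mono:
  assumes "attainable m s" "1 \<le> m" "m \<le> n"
  shows "attainable n s"
  using assms(3,1,2) by (induction n rule: dec_induct) (simp_all add: attainable_Suc)

text \<open>The \<open>K \<times> K\<close> grid with its lower left \<open>k \<times> k\<close> block merged into one square (index \<open>None\<close>), which is
  then refilled with the given packing.\<close>

lemma attainable_block:
  assumes "1 \<le> k" "k \<le> K" "attainable (k\<^sup>2 + 1) s"
  shows "attainable (K\<^sup>2 + 1) (real K + real k / real K * (s - real k))"
proof -
  define C where "C = {..<K} \<times> {..<K} - {..<k} \<times> {..<k}"
  define I where "I = insert None (Some ` C)"
  define S where "S = case_option (axis_square 0 0 (k / K))
    (\<lambda>(x, y). axis_square (real x / K) (real y / K) (1 / K))"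
  define a :: "(nat \<times> nat) option \<Rightarrow> real" where "a = case_option (k / K) (\<lambda>_. 1 / K)"
  have K: "real K > 0" using assms by auto
  have cardC: "card C = K\<^sup>2 - k\<^sup>2"
    unfolding C_def using assms(2) by (subst card_Diff_subset) (auto simp: power2_eq_square)
  have kK: "k\<^sup>2 \<le> K\<^sup>2" using assms(2) by simp
  have finC: "finite C" by (simp add: C_def)
  have cells: "i = j" if "real i / K < z" "z < real i / K + 1 / K" "real j / K < z" "z < real j / K + 1 / K"
    for i j :: nat and z :: real
  proof -
    have "real i < z * K" "z * K < real i + 1" "real j < z * K" "z * K < real j + 1"
      using that K by (simp_all add: field_simps)
    hence "real i < real j + 1" "real j < real i + 1" by linarith+
    thus ?thesis by linarith
  qed
  have block: "i < k" if "real i / K < z" "z < real k / K" for i and z :: real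
  proof -
    have "real i / K < real k / K" using that by linarith
    thus ?thesis using K by (simp add: divide_strict_right_mono field_simps)
  qed
  have sq: "is_square (S i) (a i) \<and> S i \<subseteq> unit_square" if "i \<in> I" for i
  proof (cases i)
    case None
    thus ?thesis using axis_square_in_unit_square[of "k / K" 0 0] assms K by (simp add: S_def a_def)
  next
    case (Some q)
    then obtain x y where q: "i = Some (x, y)" by (cases q) auto
    hence "real x + 1 \<le> K" "real y + 1 \<le> K" using that by (auto simp: I_def C_def)
    hence "real x / K + 1 / K \<le> 1" "real y / K + 1 / K \<le> 1"
      using K by (simp_all add: field_simps)
    thus ?thesis using axis_square_in_unit_square[of "1 / K" "x / K" "y / K"] K
      by (simp add: S_def a_def q)
  qed
  have dis: "i = j" if "i \<in> I" "j \<in> I" "z \<in> interior (S i)" "z \<in> interior (S j)" for i j z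
  proof -
    have pos: "real k / K > 0" "1 / real K > 0" using assms K by auto
    have None: "z $ 1 < k / K \<and> z $ 2 < k / K" if "z \<in> interior (S None)"
      using that pos by (simp add: S_def interior_axis_square)
    have Some: "real x / K < z $ 1 \<and> z $ 1 < real x / K + 1 / K \<and>
        real y / K < z $ 2 \<and> z $ 2 < real y / K + 1 / K" if "z \<in> interior (S (Some (x, y)))" for x y
      using that pos by (simp add: S_def interior_axis_square)
    have mixed: False if "Some (x, y) \<in> I" "z \<in> interior (S None)" "z \<in> interior (S (Some (x, y)))" for x y
    proof -
      have "x < k" "y < k" using None[OF that(2)] Some[OF that(3)] block by blast+
      thus False using that(1) by (auto simp: I_def C_def)
    qed
    have both: "x = x' \<and> y = y'"
      if "z \<in> interior (S (Some (x, y)))" "z \<in> interior (S (Some (x', y')))" for x y x' y'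
      using Some[OF that(1)] Some[OF that(2)] cells by blast
    show ?thesis
    proof (cases i)
      case i: None
      show ?thesis using that mixed unfolding i by (cases j) auto
    next
      case i: (Some q)
      show ?thesis
      proof (cases j)
        case None
        thus ?thesis using that mixed i by (cases q) blast
      next
        case (Some q')
        thus ?thesis using that both i by (cases q; cases q') blast
      qed
    qed
  qed
  have "packing_on I S a"
    using sq dis unfolding packing_on_def disjoint_family_on_def by blast
  from attainable_replace[OF _ this _ assms(3), of None]
  have "attainable (card I - 1 + (k\<^sup>2 + 1)) (sum a (I - {None}) + a None * s)"
    using finC by (simp add: I_def)
  moreover have "card I - 1 + (k\<^sup>2 + 1) = K\<^sup>2 + 1"
    using finC kK by (simp add: I_def card_image cardC)
  moreover have "sum a (I - {None}) = (real K ^ 2 - real k ^ 2) / K"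
  proof -
    have "I - {None} = Some ` C" by (auto simp: I_def)
    hence "sum a (I - {None}) = real (card C) * (1 / K)"
      by (simp add: sum.reindex a_def)
    thus ?thesis using kK by (simp add: cardC of_nat_diff)
  qed
  moreover have "(real K ^ 2 - real k ^ 2) / K + k / K * s = K + k / K * (s - k)"
    using K by (simp add: field_simps power2_eq_square)
  ultimately show ?thesis by (simp add: a_def)
qed

section \<open>The maximum is attained\<close>

abbreviation (input) "vertex w \<equiv> fst w"
abbreviation (input) "edge1 w \<equiv> fst (snd w)"
abbreviation (input) "edge2 w \<equiv> snd (snd w)"

text \<open>A square is encoded by its vertex and its two edges, and zero edges are admitted. The box
  constrains all coordinates, also those from \<open>n\<close> on: this makes the set compact in the product
  topology.\<close>

definition weak_packings :: "nat \<Rightarrow> (nat \<Rightarrow> (real ^ 2) \<times> (real ^ 2) \<times> (real ^ 2)) set" where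
  "weak_packings n = {z.
     (\<forall>i. z i \<in> unit_square \<times> cball 0 2 \<times> cball 0 2) \<and>
     (\<forall>i<n. norm (edge1 (z i)) = norm (edge2 (z i)) \<and> edge1 (z i) \<bullet> edge2 (z i) = 0) \<and>
     (\<forall>i<n. \<forall>s\<in>{0..1}. \<forall>t\<in>{0..1}. vertex (z i) + s *\<^sub>R edge1 (z i) + t *\<^sub>R edge2 (z i) \<in> unit_square) \<and>
     (\<forall>i<n. \<forall>j<n. i \<noteq> j \<longrightarrow> (\<forall>x. \<not> (x \<in> open_core (vertex (z i)) (edge1 (z i)) (edge2 (z i)) \<and>
        x \<in> open_core (vertex (z j)) (edge1 (z j)) (edge2 (z j)))))}"

text \<open>A closed subset of a product of compact sets, by Tychonoff's theorem.\<close>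

lemma compact_weak_packings: "compact (weak_packings n)"
proof -
  have "compact (unit_square \<times> cball (0 :: real ^ 2) 2 \<times> cball (0 :: real ^ 2) 2)"
    unfolding unit_square_def by (intro compact_Times) auto
  hence box: "compact {z :: nat \<Rightarrow> _. \<forall>i. z i \<in> unit_square \<times> cball (0 :: real ^ 2) 2 \<times> cball (0 :: real ^ 2) 2}"
    using compactin_PiE[of "\<lambda>_. euclidean" UNIV "\<lambda>_ :: nat. unit_square \<times> cball (0 :: real ^ 2) 2 \<times> cball (0 :: real ^ 2) 2"]
    by (simp add: euclidean_product_topology PiE_UNIV_domain Pi_def)
  have coord: "continuous_on UNIV (\<lambda>z :: nat \<Rightarrow> (real ^ 2) \<times> (real ^ 2) \<times> (real ^ 2). z i)" for i
    by simp
  note cont = continuous_intros coord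
  have frame: "closed {z :: nat \<Rightarrow> (real ^ 2) \<times> (real ^ 2) \<times> (real ^ 2).
     (\<forall>i<n. norm (edge1 (z i)) = norm (edge2 (z i)) \<and> edge1 (z i) \<bullet> edge2 (z i) = 0)}"
    by (intro closed_Collect_all closed_Collect_imp open_Collect_const closed_Collect_conj
        closed_Collect_eq cont)
  have closed_unit: "closed {z. f z \<in> unit_square}"
    if "continuous_on UNIV f" for f :: "(nat \<Rightarrow> (real ^ 2) \<times> (real ^ 2) \<times> (real ^ 2)) \<Rightarrow> real ^ 2"
    using continuous_closed_vimage[of unit_square f] that closed_vimage[of unit_square f]
    by (simp add: unit_square_def closed_cbox vimage_def)
  have inside: "closed {z :: nat \<Rightarrow> (real ^ 2) \<times> (real ^ 2) \<times> (real ^ 2). \<forall>i<n. \<forall>s\<in>{0..1}. \<forall>t\<in>{0..1}.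
      vertex (z i) + s *\<^sub>R edge1 (z i) + t *\<^sub>R edge2 (z i) \<in> unit_square}"
    unfolding Ball_def
    by (intro closed_Collect_all closed_Collect_imp open_Collect_const closed_unit cont)
  have apart: "closed {z :: nat \<Rightarrow> (real ^ 2) \<times> (real ^ 2) \<times> (real ^ 2). \<forall>i<n. \<forall>j<n. i \<noteq> j \<longrightarrow>
      (\<forall>x. \<not> (x \<in> open_core (vertex (z i)) (edge1 (z i)) (edge2 (z i)) \<and>
        x \<in> open_core (vertex (z j)) (edge1 (z j)) (edge2 (z j))))}"
    unfolding open_core_def mem_Collect_eq
    by (intro closed_Collect_all closed_Collect_imp open_Collect_const closed_Collect_neg
        open_Collect_conj open_Collect_less cont)
  show ?thesis
    using compact_Int_closed[OF compact_Int_closed[OF compact_Int_closed[OF box frame] inside] apart]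
    unfolding weak_packings_def by (simp add: Collect_conj_eq Int_assoc)
qed

lemma weak_packing_if_packing:
  assumes "packing_on {..<n} S a"
  obtains z where "z \<in> weak_packings n" "\<And>i. i < n \<Longrightarrow> a i = norm (edge1 (z i))"
proof -
  have "\<exists>w. (i < n \<longrightarrow> norm (edge1 w) = a i \<and> norm (edge2 w) = a i \<and> edge1 w \<bullet> edge2 w = 0 \<and>
      S i = parallelogram (vertex w) (edge1 w) (edge2 w)) \<and> (\<not> i < n \<longrightarrow> w = (0, 0, 0))" for i
    using assms unfolding packing_on_def is_square_iff by (cases "i < n") auto
  then obtain z where z: "\<And>i. i < n \<Longrightarrow> norm (edge1 (z i)) = a i \<and> norm (edge2 (z i)) = a i \<and>
      edge1 (z i) \<bullet> edge2 (z i) = 0 \<and> S i = parallelogram (vertex (z i)) (edge1 (z i)) (edge2 (z i))"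
    and z0: "\<And>i. \<not> i < n \<Longrightarrow> z i = (0, 0, 0)"
    by metis
  have pos: "a i > 0" if "i < n" for i
    using assms that by (auto simp: packing_on_def is_square_iff)
  have int: "interior (S i) = open_core (vertex (z i)) (edge1 (z i)) (edge2 (z i))" if "i < n" for i
  proof -
    have "edge1 (z i) \<noteq> 0" "edge2 (z i) \<noteq> 0" using z[OF that] pos[OF that] by auto
    thus ?thesis using z[OF that] interior_parallelogram by simp
  qed
  have inside: "vertex (z i) + s *\<^sub>R edge1 (z i) + t *\<^sub>R edge2 (z i) \<in> unit_square"
    if "i < n" "s \<in> {0..1}" "t \<in> {0..1}" for i s t
  proof -
    have "parallelogram (vertex (z i)) (edge1 (z i)) (edge2 (z i)) \<subseteq> unit_square"
      using assms that(1) z by (auto simp: packing_on_def)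
    thus ?thesis using that(2,3) unfolding parallelogram_def by blast
  qed
  have diff_unit: "norm (y - x) \<le> 2" if "x \<in> unit_square" "y \<in> unit_square" for x y
    using that norm_le_l1_cart[of "y - x"] by (auto simp: unit_square_iff sum_2)
  have box: "z i \<in> unit_square \<times> cball 0 2 \<times> cball 0 2" for i
  proof (cases "i < n")
    case True
    have "vertex (z i) \<in> unit_square" "vertex (z i) + edge1 (z i) \<in> unit_square"
      "vertex (z i) + edge2 (z i) \<in> unit_square"
      using inside[OF True, of 0 0] inside[OF True, of 1 0] inside[OF True, of 0 1] by auto
    thus ?thesis
      using diff_unit[of "vertex (z i)" "vertex (z i) + edge1 (z i)"]
        diff_unit[of "vertex (z i)" "vertex (z i) + edge2 (z i)"]
      by (auto simp: mem_Times_iff)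
  qed (use z0 in \<open>auto simp: unit_square_iff\<close>)
  have apart: "\<not> (x \<in> open_core (vertex (z i)) (edge1 (z i)) (edge2 (z i)) \<and>
        x \<in> open_core (vertex (z j)) (edge1 (z j)) (edge2 (z j)))"
    if "i < n" "j < n" "i \<noteq> j" for i j x
    using assms that int unfolding packing_on_def disjoint_family_on_def by blast
  have "z \<in> weak_packings n"
    unfolding weak_packings_def using box inside apart z by simp
  with z show thesis using that by metis
qed

text \<open>The squares with nonzero edges form a packing with the same side sum. There is at least one of them
  as the sum is positive, so splitting squares brings their number back up to \<open>n\<close>.\<close>

lemma attainable_if_weak_packing:
  assumes z: "z \<in> weak_packings n" and pos: "0 < (\<Sum>i<n. norm (edge1 (z i)))"
  shows "attainable n (\<Sum>i<n. norm (edge1 (z i)))"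
proof -
  define I where "I = {i. i < n \<and> edge1 (z i) \<noteq> 0}"
  define S where "S i = parallelogram (vertex (z i)) (edge1 (z i)) (edge2 (z i))" for i
  define a where "a i = norm (edge1 (z i))" for i
  have frame: "norm (edge1 (z i)) = norm (edge2 (z i))" "edge1 (z i) \<bullet> edge2 (z i) = 0" if "i < n" for i
    using z that by (auto simp: weak_packings_def)
  have nz: "edge2 (z i) \<noteq> 0" if "i \<in> I" for i
    using frame(1)[of i] that by (auto simp: I_def)
  have int: "interior (S i) = open_core (vertex (z i)) (edge1 (z i)) (edge2 (z i))" if "i \<in> I" for i
    unfolding S_def using that nz frame by (intro interior_parallelogram) (auto simp: I_def)
  have "is_square (S i) (a i)" if "i \<in> I" for i
    unfolding is_square_iff S_def a_def using that frame[of i] by (auto simp: I_def)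
  moreover have "S i \<subseteq> unit_square" if "i \<in> I" for i
    using z that unfolding weak_packings_def S_def parallelogram_def I_def by blast
  moreover have "interior (S i) \<inter> interior (S j) = {}" if "i \<in> I" "j \<in> I" "i \<noteq> j" for i j
    using z that int[of i] int[of j] unfolding weak_packings_def I_def by blast
  ultimately have "packing_on I S a"
    unfolding packing_on_def disjoint_family_on_def by blast
  moreover have fin: "finite I" by (simp add: I_def)
  ultimately have "attainable (card I) (sum a I)" by (rule packing_on_imp_attainable[rotated])
  moreover have sum: "sum a I = (\<Sum>i<n. norm (edge1 (z i)))"
    unfolding I_def a_def by (intro sum.mono_neutral_left) auto
  moreover have "1 \<le> card I"
  proof -
    have "I \<noteq> {}" using pos sum by auto
    thus ?thesis using fin by (simp add: Suc_le_eq card_gt_0_iff)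
  qed
  moreover have "card I \<le> n"
    using card_mono[of "{..<n}" I] by (auto simp: I_def)
  ultimately show ?thesis using attainable_mono by metis
qed

lemma maximum_attained:
  assumes "n \<ge> 1"
  shows "\<exists>s. attainable n s \<and> (\<forall>s'. attainable n s' \<longrightarrow> s' \<le> s)"
proof -
  let ?g = "\<lambda>z :: nat \<Rightarrow> (real ^ 2) \<times> (real ^ 2) \<times> (real ^ 2). \<Sum>i<n. norm (edge1 (z i))"
  have ex: "\<exists>z\<in>weak_packings n. ?g z = s" if att: "attainable n s" for s
  proof -
    obtain S a where "packing_on {..<n} S a" and s: "s = (\<Sum>i<n. a i)"
      using att by (auto simp: attainable_def square_packing_eq)
    then obtain z where "z \<in> weak_packings n" "\<And>i. i < n \<Longrightarrow> a i = norm (edge1 (z i))"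
      using weak_packing_if_packing by metis
    thus ?thesis using s by (auto intro!: bexI[of _ z])
  qed
  have one: "attainable n 1" using attainable_mono[OF attainable_one] assms by simp
  have coord: "continuous_on UNIV (\<lambda>z :: nat \<Rightarrow> (real ^ 2) \<times> (real ^ 2) \<times> (real ^ 2). z i)" for i
    by simp
  have "continuous_on UNIV ?g" by (intro continuous_intros coord)
  hence "continuous_on (weak_packings n) ?g" by (rule continuous_on_subset) simp
  then obtain z where z: "z \<in> weak_packings n" "\<And>y. y \<in> weak_packings n \<Longrightarrow> ?g y \<le> ?g z"
    using continuous_attains_sup[OF compact_weak_packings, of n ?g] ex[OF one] by blast
  have ub: "s \<le> ?g z" if "attainable n s" for s using ex[OF that] z(2) by blast
  have "attainable n (?g z)"
    using attainable_if_weak_packing[OF z(1)] ub[OF one] by linarith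
  with ub show ?thesis by blast
qed

lemma attainable_max_side_sum:
  assumes "n \<ge> 1"
  shows "attainable n (max_side_sum n)" "attainable n s \<Longrightarrow> s \<le> max_side_sum n"
proof -
  obtain m where m: "attainable n m" "\<And>s'. attainable n s' \<Longrightarrow> s' \<le> m"
    using maximum_attained[OF assms] by blast
  have "max_side_sum n = (GREATEST s. attainable n s)"
    by (simp add: max_side_sum_def attainable_def)
  also have "\<dots> = m" using m by (intro Greatest_equality)
  finally show "attainable n (max_side_sum n)" "attainable n s \<Longrightarrow> s \<le> max_side_sum n"
    using m by auto
qed

section \<open>The excess decays no faster than the harmonic sequence\<close>

text \<open>Two half-size squares in one cell of the \<open>k \<times> k\<close> grid show that the side sum \<open>k\<close> is attained.\<close>

lemma excess_nonneg:
  assumes "k \<ge> 1"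
  shows "excess k \<ge> 0"
proof -
  have "attainable (k\<^sup>2 + 1) (real k + real 1 / real k * (1 - real 1))"
    using attainable_block[of 1 k 1] assms attainable_two by (simp add: numeral_2_eq_2)
  thus ?thesis using attainable_max_side_sum(2)[of "k\<^sup>2 + 1"] by (simp add: excess_def)
qed

lemma excess_lower_bound:
  assumes "1 \<le> k" "k \<le> K"
  shows "real k / real K * excess k \<le> excess K"
proof -
  have "attainable (k\<^sup>2 + 1) (max_side_sum (k\<^sup>2 + 1))" by (intro attainable_max_side_sum) simp
  from attainable_block[OF assms this] show ?thesis
    using attainable_max_side_sum(2)[of "K\<^sup>2 + 1"] by (force simp: excess_def)
qed

lemma excess_eq_0_if_summable:
  assumes "summable (\<lambda>k. excess (Suc k))" "k \<ge> 1"
  shows "excess k = 0"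
proof (rule ccontr)
  assume "excess k \<noteq> 0"
  hence c: "real k * excess k > 0" using excess_nonneg[OF assms(2)] assms(2) by simp
  have "summable excess" using assms(1) by (subst (asm) summable_Suc_iff)
  hence "summable (\<lambda>K. real k * excess k * inverse (real K))"
  proof (rule summable_comparison_test'[where N = k])
    fix K assume "K \<ge> k"
    thus "norm (real k * excess k * inverse (real K)) \<le> excess K"
      using excess_lower_bound[OF assms(2), of K] c by (simp add: field_simps)
  qed
  hence "summable (\<lambda>K. inverse (real K))"
    using c by (subst (asm) summable_cmult_iff) auto
  thus False using not_summable_harmonic[where 'a = real] by simp
qed

lemma excess_eq_0_mono:
  assumes "excess K = 0" "1 \<le> k" "k \<le> K"
  shows "excess k = 0"
proof -
  have "real k / real K * excess k \<le> 0" using excess_lower_bound[OF assms(2,3)] assms(1) by simp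
  moreover have "real k / real K > 0" using assms(2,3) by simp
  ultimately have "excess k \<le> 0" by (meson mult_pos_pos not_less)
  thus ?thesis using excess_nonneg[OF assms(2)] by simp
qed

theorem mainTheorem3:
  shows "((\<forall>k\<ge>1. max_side_sum (k\<^sup>2 + 1) = real k) \<longleftrightarrow> summable (\<lambda>k. excess (Suc k))) \<and>
         (infinite {k. k \<ge> 1 \<and> max_side_sum (k\<^sup>2 + 1) = real k} \<longrightarrow>
           (\<forall>k\<ge>1. max_side_sum (k\<^sup>2 + 1) = real k))"
proof -
  have zero: "max_side_sum (k\<^sup>2 + 1) = real k \<longleftrightarrow> excess k = 0" for k
    by (auto simp: excess_def)
  have "summable (\<lambda>k. excess (Suc k))" if "\<forall>k\<ge>1. excess k = 0"
    using that by simp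
  moreover have "\<forall>k\<ge>1. excess k = 0" if "infinite {k. k \<ge> 1 \<and> excess k = 0}"
  proof (intro allI impI)
    fix k :: nat assume "k \<ge> 1"
    moreover obtain K where "K \<ge> k" "excess K = 0"
      using \<open>infinite {k. k \<ge> 1 \<and> excess k = 0}\<close> unfolding infinite_nat_iff_unbounded_le by blast
    ultimately show "excess k = 0" using excess_eq_0_mono by blast
  qed
  ultimately show ?thesis
    unfolding zero using excess_eq_0_if_summable by blast
qed

end
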